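(* Let $\boldsymbol A$ be the real $4\times n$ payoff matrix (payoffs to the row player) of a matrix game in which the row player is required to use a mixed strategy of the form $\boldsymbol p=((1-p_1)(1-p_2),(1-p_1)p_2,p_1(1-p_2),p_1p_2)$ for some $p_1,p_2\in[0,1]$; write $\Delta_2\times\Delta_2\subset\Delta_4$ for the set of such $\boldsymbol p$. Then the lower value of this constrained game is $$\underline v=\max_{\boldsymbol p\in\Delta_2\times\Delta_2}\ \min_{\boldsymbol q\in\Delta_n}\boldsymbol p\boldsymbol A\boldsymbol q^{\mathsf T}=\max_{\boldsymbol p\in\Delta_2\times\Delta_2}\ \min_{1\le j\le n}(\boldsymbol p\boldsymbol A)_j ,$$ while the upper value of this constrained game is $$\overline v=\max_{\boldsymbol p\in\Delta_4}\ \min_{\boldsymbol q\in\Delta_n}\boldsymbol p\boldsymbol A\boldsymbol q^{\mathsf T}=\max_{\boldsymbol p\in\Delta_4}\ \min_{1\le j\le n}(\boldsymbol p\boldsymbol A)_j ,$$ which is equal to the value of the unconstrained matrix game $\boldsymbol A$. In particular, $\underline v=\overline v$ if and only if the maximum over $\boldsymbol p\in\Delta_4$ in the formula for $\overline v$ occurs at a point of $\Delta_2\times\Delta_2$.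
   Context: $\Delta_n:=\{\boldsymbol p=(p_1,\ldots,p_n)\in[0,1]^n:p_1+\cdots+p_n=1\}$, whose elements are row vectors. The column player may use any $\boldsymbol q\in\Delta_n$. By definition, the lower value of the constrained game is $\underline v=\max_{\boldsymbol p\in\Delta_2\times\Delta_2}\min_{\boldsymbol q\in\Delta_n}\boldsymbol p\boldsymbol A\boldsymbol q^{\mathsf T}$ and the upper value of the constrained game is $\overline v=\min_{\boldsymbol q\in\Delta_n}\max_{\boldsymbol p\in\Delta_2\times\Delta_2}\boldsymbol p\boldsymbol A\boldsymbol q^{\mathsf T}$. The value of the unconstrained game is the usual minimax value with $\boldsymbol p$ ranging over all of $\Delta_4$. *)

theory Defs
  imports "HOL-Analysis.Analysis"
begin

definition prob_simplex :: "(real ^ 'n) set" where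
  "prob_simplex = {p. (\<forall>i. p $ i \<in> {0..1}) \<and> (\<Sum>i\<in>UNIV. p $ i) = 1}"

text \<open>The four pure strategies of the row player are pairs of bits, listed in the order
  00, 01, 10, 11; the two bits are chosen independently, with probabilities \<open>p1\<close> and \<open>p2\<close>
  of being 1.\<close>

definition product_strategies :: "(real ^ 4) set" where
  "product_strategies =
     {vector [(1 - p1) * (1 - p2), (1 - p1) * p2, p1 * (1 - p2), p1 * p2] | p1 p2.
        p1 \<in> {0..1} \<and> p2 \<in> {0..1}}"

definition payoff :: "real ^ 'n ^ 'm \<Rightarrow> real ^ 'm \<Rightarrow> real ^ 'n \<Rightarrow> real" where
  "payoff A p q = (p v* A) \<bullet> q"

text \<open>Maxima and minima over possibly infinite sets (\<^const>\<open>Max\<close> and \<^const>\<open>Min\<close> only cover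
  finite ones). The values \<open>max_on\<close> and \<open>min_on\<close> are meaningful only if an extremal point
  exists, which is what \<open>attains_max\<close> and \<open>attains_min\<close> express.\<close>

definition max_on :: "'a set \<Rightarrow> ('a \<Rightarrow> real) \<Rightarrow> real" where
  "max_on S f = (GREATEST v. v \<in> f ` S)"

definition min_on :: "'a set \<Rightarrow> ('a \<Rightarrow> real) \<Rightarrow> real" where
  "min_on S f = (LEAST v. v \<in> f ` S)"

definition attains_max :: "'a set \<Rightarrow> ('a \<Rightarrow> real) \<Rightarrow> bool" where
  "attains_max S f \<longleftrightarrow> (\<exists>x. is_arg_max f (\<lambda>x. x \<in> S) x)"

definition attains_min :: "'a set \<Rightarrow> ('a \<Rightarrow> real) \<Rightarrow> bool" where
  "attains_min S f \<longleftrightarrow> (\<exists>x. is_arg_min f (\<lambda>x. x \<in> S) x)"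

text \<open>The game in which the row player is restricted to mixed strategies in \<open>P\<close>, while the column
  player may use every mixed strategy.\<close>

definition lower_value :: "(real ^ 'm) set \<Rightarrow> real ^ 'n ^ 'm \<Rightarrow> real" where
  "lower_value P A = max_on P (\<lambda>p. min_on prob_simplex (\<lambda>q. payoff A p q))"

definition upper_value :: "(real ^ 'm) set \<Rightarrow> real ^ 'n ^ 'm \<Rightarrow> real" where
  "upper_value P A = min_on prob_simplex (\<lambda>q. max_on P (\<lambda>p. payoff A p q))"

text \<open>All maxima and minima occurring in \<open>lower_value P A\<close> and \<open>upper_value P A\<close> are attained.\<close>

definition values_attained :: "(real ^ 'm) set \<Rightarrow> real ^ 'n ^ 'm \<Rightarrow> bool" where
  "values_attained P A \<longleftrightarrow>
     (\<forall>p\<in>P. attains_min prob_simplex (\<lambda>q. payoff A p q)) \<and>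
     attains_max P (\<lambda>p. min_on prob_simplex (\<lambda>q. payoff A p q)) \<and>
     (\<forall>q\<in>prob_simplex. attains_max P (\<lambda>p. payoff A p q)) \<and>
     attains_min prob_simplex (\<lambda>q. max_on P (\<lambda>p. payoff A p q))"

definition is_game_value :: "real ^ 'n ^ 'm \<Rightarrow> real \<Rightarrow> bool" where
  "is_game_value A v \<longleftrightarrow>
     values_attained prob_simplex A \<and>
     lower_value prob_simplex A = v \<and> upper_value prob_simplex A = v"

lemma vector_4:
  "(vector [w, x, y, z] :: 'a::zero ^ 4) $ 1 = w"
  "(vector [w, x, y, z] :: 'a::zero ^ 4) $ 2 = x"
  "(vector [w, x, y, z] :: 'a::zero ^ 4) $ 3 = y"
  "(vector [w, x, y, z] :: 'a::zero ^ 4) $ 4 = z"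
  unfolding vector_def by auto

lemma product_strategies_subset: "product_strategies \<subseteq> prob_simplex"
proof
  fix p assume "p \<in> product_strategies"
  then obtain a b :: real
    where p: "p = vector [(1 - a) * (1 - b), (1 - a) * b, a * (1 - b), a * b]"
      and ab: "0 \<le> a" "a \<le> 1" "0 \<le> b" "b \<le> 1"
    by (auto simp: product_strategies_def)
  have in01: "0 \<le> x * y \<and> x * y \<le> 1" if "0 \<le> x" "x \<le> 1" "0 \<le> y" "y \<le> 1" for x y :: real
    using that by (simp add: mult_le_one)
  have "\<forall>i. p $ i \<in> {0..1}"
    using in01[of "1 - a" "1 - b"] in01[of "1 - a" b] in01[of a "1 - b"] in01[of a b] ab
    unfolding p forall_4 vector_4 atLeastAtMost_iff by simp
  moreover have "(\<Sum>i\<in>UNIV. p $ i) = 1"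
    unfolding p sum_4 vector_4 by (simp add: algebra_simps)
  ultimately show "p \<in> prob_simplex"
    by (simp add: prob_simplex_def)
qed

end

theory Submission
  imports Defs
begin

text \<open>
  A linear functional on a simplex takes its extreme values at vertices. So for every mixed
  strategy \<open>p\<close> the column player's best reply is worth \<open>MIN j. (p v* A) $ j\<close>, and for every \<open>q\<close>
  the row player's best reply is worth \<open>MAX i. (A *v q) $ i\<close> (lemmas \<open>min_on_prob_simplex\<close> and
  \<open>max_on_payoff\<close>). The second fact holds for every part \<open>P\<close> of the simplex that contains
  its vertices. The product strategies form such a set: the vertices arise when \<open>p1\<close> and \<open>p2\<close>
  are 0 or 1. Hence the upper value is the same whether the row player is restricted to \<open>P\<close>
  or not: a player who moves second and sees \<open>q\<close> has no use for mixing.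

  By the minimax theorem (\<open>saddle_point_exists\<close>) the upper value of the unrestricted game is its
  lower value, the maximum of \<open>MIN j. (p v* A) $ j\<close> over the whole simplex. The lower value of the
  restricted game is the maximum of the same function over the subset \<open>P\<close>, so the two values agree
  exactly when some maximum point over the simplex lies in \<open>P\<close>. All extrema exist because the sets
  are compact and the functions continuous.
\<close>

section \<open>Attained extrema\<close>

lemma max_on_eq_arg_max:
  assumes "is_arg_max f (\<lambda>x. x \<in> S) x"
  shows "max_on S f = f x"
  unfolding max_on_def
  using assms by (intro Greatest_equality) (auto simp: is_arg_max_linorder)

lemma min_on_eq_arg_min:
  assumes "is_arg_min f (\<lambda>x. x \<in> S) x"
  shows "min_on S f = f x"
  unfolding min_on_def
  using assms by (intro Least_equality) (auto simp: is_arg_min_linorder)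

lemma attains_max_compact:
  fixes f :: "'a::topological_space \<Rightarrow> real"
  assumes "compact S" "S \<noteq> {}" "continuous_on S f"
  shows "attains_max S f"
  using continuous_attains_sup[OF assms] by (auto simp: attains_max_def is_arg_max_linorder)

lemma attains_min_compact:
  fixes f :: "'a::topological_space \<Rightarrow> real"
  assumes "compact S" "S \<noteq> {}" "continuous_on S f"
  shows "attains_min S f"
  using continuous_attains_inf[OF assms] by (auto simp: attains_min_def is_arg_min_linorder)

lemma max_on_subset_eq_iff:
  assumes "P \<subseteq> S" "attains_max P f" "attains_max S f"
  shows "max_on P f = max_on S f \<longleftrightarrow> (\<exists>p\<in>P. is_arg_max f (\<lambda>x. x \<in> S) p)"
proof -
  obtain x y where x: "is_arg_max f (\<lambda>x. x \<in> P) x" and y: "is_arg_max f (\<lambda>x. x \<in> S) y"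
    using assms by (auto simp: attains_max_def)
  show ?thesis
    unfolding max_on_eq_arg_max[OF x] max_on_eq_arg_max[OF y]
  proof
    assume "f x = f y"
    then have "is_arg_max f (\<lambda>x. x \<in> S) x"
      using x y assms(1) by (auto simp: is_arg_max_linorder)
    then show "\<exists>p\<in>P. is_arg_max f (\<lambda>x. x \<in> S) p"
      using x by (auto simp: is_arg_max_linorder)
  next
    assume "\<exists>p\<in>P. is_arg_max f (\<lambda>x. x \<in> S) p"
    then obtain p where p: "p \<in> P" "is_arg_max f (\<lambda>x. x \<in> S) p" by blast
    have "f p \<le> f x" "f y \<le> f p" "f x \<le> f y"
      using p x y assms(1) by (auto simp: is_arg_max_linorder)
    then show "f x = f y" by simp
  qed
qed

lemma continuous_on_Min_image:
  fixes f :: "'i \<Rightarrow> 'a::topological_space \<Rightarrow> 'b::linorder_topology"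
  assumes "finite I" "I \<noteq> {}" "\<And>i. i \<in> I \<Longrightarrow> continuous_on S (f i)"
  shows "continuous_on S (\<lambda>x. MIN i\<in>I. f i x)"
  using assms by (induction I rule: finite_ne_induct) (auto intro: continuous_on_min)

lemma continuous_on_Max_image:
  fixes f :: "'i \<Rightarrow> 'a::topological_space \<Rightarrow> 'b::linorder_topology"
  assumes "finite I" "I \<noteq> {}" "\<And>i. i \<in> I \<Longrightarrow> continuous_on S (f i)"
  shows "continuous_on S (\<lambda>x. MAX i\<in>I. f i x)"
  using assms by (induction I rule: finite_ne_induct) (auto intro: continuous_on_max)

section \<open>Linear functionals on the probability simplex\<close>

lemma axis_in_prob_simplex: "axis i 1 \<in> prob_simplex"
  by (auto simp: prob_simplex_def axis_def)

lemma prob_simplex_nonempty: "prob_simplex \<noteq> {}"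
  using axis_in_prob_simplex by blast

lemma compact_prob_simplex: "compact (prob_simplex :: (real ^ 'n) set)"
proof -
  have "prob_simplex = cbox 0 (1 :: real ^ 'n) \<inter> {p. (\<Sum>i\<in>UNIV. p $ i) = 1}"
    by (auto simp: prob_simplex_def mem_box_cart)
  moreover have "closed {p :: real ^ 'n. (\<Sum>i\<in>UNIV. p $ i) = 1}"
    by (intro closed_Collect_eq continuous_intros)
  ultimately show ?thesis by (metis compact_Int_closed compact_cbox)
qed

lemma convex_prob_simplex: "convex (prob_simplex :: (real ^ 'n) set)"
proof -
  have "prob_simplex = cbox 0 (1 :: real ^ 'n) \<inter> {p. 1 \<bullet> p = 1}"
    by (auto simp: prob_simplex_def mem_box_cart inner_vec_def)
  then show ?thesis by (metis convex_Int convex_box(1) convex_hyperplane)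
qed

lemma Min_le_inner_prob_simplex:
  fixes x q :: "real ^ 'n"
  assumes "q \<in> prob_simplex"
  shows "(MIN j. x $ j) \<le> x \<bullet> q"
proof -
  have "(MIN j. x $ j) = (\<Sum>j\<in>UNIV. (MIN j. x $ j) * q $ j)"
    using assms by (simp add: prob_simplex_def flip: sum_distrib_left)
  also have "\<dots> \<le> (\<Sum>j\<in>UNIV. x $ j * q $ j)"
    using assms by (intro sum_mono mult_right_mono) (auto simp: prob_simplex_def)
  finally show ?thesis by (simp add: inner_vec_def)
qed

lemma inner_prob_simplex_le_Max:
  fixes x p :: "real ^ 'n"
  assumes "p \<in> prob_simplex"
  shows "p \<bullet> x \<le> (MAX i. x $ i)"
proof -
  have "p \<bullet> x = (\<Sum>i\<in>UNIV. p $ i * x $ i)"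
    by (simp add: inner_vec_def)
  also have "\<dots> \<le> (\<Sum>i\<in>UNIV. p $ i * (MAX i. x $ i))"
    using assms by (intro sum_mono mult_left_mono) (auto simp: prob_simplex_def)
  also have "\<dots> = (MAX i. x $ i)"
    using assms by (simp add: prob_simplex_def flip: sum_distrib_right)
  finally show ?thesis .
qed

lemma arg_min_inner_vertex:
  fixes x :: "real ^ 'n"
  obtains j where "is_arg_min (\<lambda>q. x \<bullet> q) (\<lambda>q. q \<in> prob_simplex) (axis j 1)"
    "x $ j = (MIN j. x $ j)"
proof -
  have "(MIN j. x $ j) \<in> range (($) x)" by (intro Min_in) auto
  then obtain j where j: "x $ j = (MIN j. x $ j)" by (metis imageE)
  have "x $ j \<le> x \<bullet> q" if "q \<in> prob_simplex" for q
    unfolding j by (rule Min_le_inner_prob_simplex[OF that])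
  then have "is_arg_min (\<lambda>q. x \<bullet> q) (\<lambda>q. q \<in> prob_simplex) (axis j 1)"
    by (simp add: is_arg_min_linorder axis_in_prob_simplex inner_axis)
  then show thesis using j that by blast
qed

text \<open>The maximum over the whole simplex is attained at a vertex, and \<open>P\<close> lies between the set of
  vertices and the simplex.\<close>

lemma arg_max_inner_vertex:
  fixes x :: "real ^ 'm"
  assumes "range (\<lambda>i. axis i 1) \<subseteq> P" "P \<subseteq> prob_simplex"
  obtains i where "is_arg_max (\<lambda>p. p \<bullet> x) (\<lambda>p. p \<in> P) (axis i 1)"
    "x $ i = (MAX i. x $ i)"
proof -
  have "(MAX i. x $ i) \<in> range (($) x)" by (intro Max_in) auto
  then obtain i where i: "x $ i = (MAX i. x $ i)" by (metis imageE)
  have "p \<bullet> x \<le> x $ i" if "p \<in> P" for p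
    unfolding i using that assms(2) by (intro inner_prob_simplex_le_Max) blast
  then have "is_arg_max (\<lambda>p. p \<bullet> x) (\<lambda>p. p \<in> P) (axis i 1)"
    using assms(1) by (auto simp: is_arg_max_linorder inner_axis')
  then show thesis using i that by blast
qed

section \<open>Best replies\<close>

lemma payoff_eq_inner_row: "payoff A p q = p \<bullet> (A *v q)"
  unfolding payoff_def by (simp add: dot_lmul_matrix)

lemma min_on_prob_simplex: "min_on prob_simplex (\<lambda>q. payoff A p q) = (MIN j. (p v* A) $ j)"
  unfolding payoff_def
  by (rule arg_min_inner_vertex[of "p v* A"]) (simp add: min_on_eq_arg_min inner_axis)

lemma attains_min_payoff: "attains_min prob_simplex (\<lambda>q. payoff A p q)"
  unfolding payoff_def attains_min_def by (rule arg_min_inner_vertex[of "p v* A"]) blast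

lemma max_on_payoff:
  assumes "range (\<lambda>i. axis i 1) \<subseteq> P" "P \<subseteq> prob_simplex"
  shows "max_on P (\<lambda>p. payoff A p q) = (MAX i. (A *v q) $ i)"
  unfolding payoff_eq_inner_row
  by (rule arg_max_inner_vertex[OF assms, of "A *v q"]) (simp add: max_on_eq_arg_max inner_axis')

lemma attains_max_payoff:
  assumes "range (\<lambda>i. axis i 1) \<subseteq> P" "P \<subseteq> prob_simplex"
  shows "attains_max P (\<lambda>p. payoff A p q)"
  unfolding payoff_eq_inner_row attains_max_def
  by (rule arg_max_inner_vertex[OF assms, of "A *v q"]) blast

lemma attains_max_Min:
  assumes "compact P" "P \<noteq> {}"
  shows "attains_max P (\<lambda>p. MIN j. (p v* A) $ j)"
  using assms
  by (intro attains_max_compact continuous_on_Min_image)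
    (auto simp: vector_matrix_mult_def intro!: continuous_intros)

lemma attains_min_Max: "attains_min prob_simplex (\<lambda>q. MAX i. (A *v q) $ i)"
  using compact_prob_simplex prob_simplex_nonempty
  by (intro attains_min_compact continuous_on_Max_image)
    (auto simp: matrix_vector_mult_def intro!: continuous_intros)

lemma upper_value_eq:
  assumes "range (\<lambda>i. axis i 1) \<subseteq> P" "P \<subseteq> prob_simplex"
  shows "upper_value P A = min_on prob_simplex (\<lambda>q. MAX i. (A *v q) $ i)"
  by (simp add: upper_value_def max_on_payoff[OF assms])

lemma lower_value_eq: "lower_value P A = max_on P (\<lambda>p. MIN j. (p v* A) $ j)"
  by (simp add: lower_value_def min_on_prob_simplex)

lemma values_attained_if_compact:
  assumes "compact P" "range (\<lambda>i. axis i 1) \<subseteq> P" "P \<subseteq> prob_simplex"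
  shows "values_attained P A"
proof -
  have "P \<noteq> {}" using assms(2) by blast
  then show ?thesis
    unfolding values_attained_def min_on_prob_simplex max_on_payoff[OF assms(2,3)]
    using attains_min_payoff attains_max_payoff[OF assms(2,3)] attains_max_Min[OF assms(1)]
      attains_min_Max by blast
qed

section \<open>The minimax theorem\<close>

text \<open>If every \<open>q\<close> leaves the row player a reply worth at least \<open>v\<close>, then the convex set of the
  vectors \<open>A *v q\<close> misses the open orthant of vectors with all entries below \<open>v\<close>. A separating
  hyperplane has a nonnegative normal vector, because the orthant is unbounded in every
  negative direction; scaled to sum 1, the normal is a strategy that guarantees \<open>v\<close>.\<close>

lemma guaranteeing_strategy_exists:
  fixes A :: "real ^ 'n ^ 'm"
  assumes v: "\<And>q. q \<in> prob_simplex \<Longrightarrow> v \<le> (MAX i. (A *v q) $ i)"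
  obtains p where "p \<in> prob_simplex" "v \<le> (MIN j. (p v* A) $ j)"
proof -
  define D where "D = {y :: real ^ 'm. \<forall>i. y $ i < v}"
  define C where "C = (*v) A ` prob_simplex"
  have "convex C"
    unfolding C_def by (intro convex_linear_image convex_prob_simplex matrix_vector_mul_linear)
  moreover have "convex D"
  proof -
    have "D = (\<Inter>i. {y. axis i 1 \<bullet> y < v})"
      by (auto simp: D_def inner_axis')
    then show ?thesis by (simp add: convex_INT convex_halfspace_lt)
  qed
  moreover have "C \<noteq> {}" using prob_simplex_nonempty by (simp add: C_def)
  moreover have const_in_D: "(\<chi> i. v - e) \<in> D" if "e > 0" for e
    using that by (simp add: D_def)
  then have "D \<noteq> {}" using zero_less_one by blast
  moreover have "D \<inter> C = {}"
  proof -
    have "A *v q \<notin> D" if "q \<in> prob_simplex" for q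
    proof
      assume "A *v q \<in> D"
      then have "(MAX i. (A *v q) $ i) < v" by (subst Max_less_iff) (auto simp: D_def)
      then show False using v[OF that] by linarith
    qed
    then show ?thesis by (auto simp: C_def)
  qed
  ultimately obtain a b where a: "a \<noteq> 0" and below: "\<And>y. y \<in> D \<Longrightarrow> a \<bullet> y \<le> b"
    and above: "\<And>y. y \<in> C \<Longrightarrow> b \<le> a \<bullet> y"
    using separating_hyperplane_sets[of D C] by blast
  have nonneg: "0 \<le> a $ i" for i
  proof (rule ccontr)
    assume neg: "\<not> 0 \<le> a $ i"
    define w :: "real ^ 'm" where "w = (\<chi> i. v - 1)"
    \<comment> \<open>Far enough in the direction of \<open>- axis i 1\<close> the functional exceeds \<open>b\<close>.\<close>
    define t where "t = (\<bar>b - a \<bullet> w\<bar> + 1) / - (a $ i)"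
    have "t \<ge> 0" using neg by (simp add: t_def divide_nonneg_neg)
    then have "w - t *\<^sub>R axis i 1 \<in> D"
      by (auto simp: D_def w_def axis_def)
    then have "a \<bullet> (w - t *\<^sub>R axis i 1) \<le> b" by (rule below)
    then have "a \<bullet> w - t * a $ i \<le> b"
      by (simp add: inner_diff_right inner_axis)
    moreover have "t * a $ i = - (\<bar>b - a \<bullet> w\<bar> + 1)"
      using neg by (simp add: t_def)
    ultimately show False by linarith
  qed
  define s where "s = (\<Sum>i\<in>UNIV. a $ i)"
  have s: "s > 0"
  proof -
    obtain i where "a $ i \<noteq> 0" using a by (auto simp: vec_eq_iff)
    then show ?thesis
      unfolding s_def using nonneg by (intro sum_pos2[of _ i]) (auto simp: less_le)
  qed
  define p where "p = (1 / s) *\<^sub>R a"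
  have p: "p \<in> prob_simplex"
  proof -
    have "a $ i \<le> s" for i
      unfolding s_def using nonneg by (intro member_le_sum) auto
    then show ?thesis
      using s nonneg by (simp add: prob_simplex_def p_def s_def flip: sum_divide_distrib)
  qed
  \<comment> \<open>The constant vector \<open>v\<close> lies on the boundary of the orthant, so it is approached from inside.\<close>
  have sv: "s * v \<le> b"
  proof (rule field_le_epsilon)
    fix e :: real assume "e > 0"
    then have "a \<bullet> (\<chi> i. v - e / s) \<le> b" using s by (intro below const_in_D) simp
    moreover have "a \<bullet> (\<chi> i. v - e / s) = s * (v - e / s)"
      by (simp add: inner_vec_def s_def flip: sum_distrib_right)
    ultimately show "s * v \<le> b + e" using s by (simp add: algebra_simps)
  qed
  have "v \<le> (p v* A) $ j" for j
  proof -
    have "s * v \<le> a \<bullet> (A *v axis j 1)"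
      using sv above[of "A *v axis j 1"] axis_in_prob_simplex by (fastforce simp: C_def)
    then have "v \<le> p \<bullet> (A *v axis j 1)"
      using s by (simp add: p_def field_simps)
    then show ?thesis by (simp add: inner_axis flip: dot_lmul_matrix)
  qed
  then have "v \<le> (MIN j. (p v* A) $ j)" by (subst Min_ge_iff) auto
  then show thesis using p that by blast
qed

text \<open>The least value \<open>v\<close> of \<open>MAX i. (A *v q) $ i\<close> satisfies the hypothesis of
  \<open>guaranteeing_strategy_exists\<close>, so some \<open>p\<close> guarantees \<open>v\<close>; no \<open>p\<close> guarantees more, because
  the optimal \<open>q\<close> holds every \<open>p\<close> down to \<open>v\<close>.\<close>

lemma saddle_point_exists:
  fixes A :: "real ^ 'n ^ 'm"
  obtains p q where
    "is_arg_max (\<lambda>p. MIN j. (p v* A) $ j) (\<lambda>p. p \<in> prob_simplex) p"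
    "is_arg_min (\<lambda>q. MAX i. (A *v q) $ i) (\<lambda>q. q \<in> prob_simplex) q"
    "(MIN j. (p v* A) $ j) = (MAX i. (A *v q) $ i)"
proof -
  obtain q where q: "is_arg_min (\<lambda>q. MAX i. (A *v q) $ i) (\<lambda>q. q \<in> prob_simplex) q"
    using attains_min_Max by (auto simp: attains_min_def)
  then have q_simplex: "q \<in> prob_simplex" by (simp add: is_arg_min_def)
  obtain p where p: "p \<in> prob_simplex" "(MAX i. (A *v q) $ i) \<le> (MIN j. (p v* A) $ j)"
    using guaranteeing_strategy_exists[of "MAX i. (A *v q) $ i" A] q
    by (auto simp: is_arg_min_linorder)
  have weak: "(MIN j. (r v* A) $ j) \<le> (MAX i. (A *v q) $ i)" if "r \<in> prob_simplex" for r
  proof -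
    have "(MIN j. (r v* A) $ j) \<le> (r v* A) \<bullet> q"
      by (rule Min_le_inner_prob_simplex[OF q_simplex])
    also have "\<dots> \<le> (MAX i. (A *v q) $ i)"
      unfolding dot_lmul_matrix by (rule inner_prob_simplex_le_Max[OF that])
    finally show ?thesis .
  qed
  have "is_arg_max (\<lambda>p. MIN j. (p v* A) $ j) (\<lambda>p. p \<in> prob_simplex) p"
    unfolding is_arg_max_linorder using p weak by (blast intro: order_trans)
  moreover have "(MIN j. (p v* A) $ j) = (MAX i. (A *v q) $ i)"
    using p weak by (simp add: order_antisym)
  ultimately show thesis using q that by blast
qed

lemma minimax:
  "min_on prob_simplex (\<lambda>q. MAX i. (A *v q) $ i) = max_on prob_simplex (\<lambda>p. MIN j. (p v* A) $ j)"
  by (rule saddle_point_exists[of A]) (simp add: max_on_eq_arg_max min_on_eq_arg_min)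

section \<open>Independent choice of two bits\<close>

lemma compact_product_strategies: "compact product_strategies"
proof -
  define f :: "real \<times> real \<Rightarrow> real ^ 4" where
    "f = (\<lambda>(a, b). vector [(1 - a) * (1 - b), (1 - a) * b, a * (1 - b), a * b])"
  have "product_strategies = f ` ({0..1} \<times> {0..1})"
    by (auto simp: product_strategies_def f_def) blast
  moreover have "continuous_on ({0..1} \<times> {0..1}) f"
  proof -
    have "\<forall>i. continuous_on ({0..1} \<times> {0..1}) (\<lambda>x. f x $ i)"
      unfolding forall_4 f_def case_prod_beta vector_4 by (intro conjI continuous_intros)
    then have "continuous_on ({0..1} \<times> {0..1}) (\<lambda>x. \<chi> i. f x $ i)"
      by (intro continuous_on_vec_lambda) blast
    then show ?thesis by simp
  qed
  ultimately show ?thesis by (metis compact_continuous_image compact_Times compact_Icc)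
qed

lemma axis_in_product_strategies: "range (\<lambda>i. axis i 1) \<subseteq> product_strategies"
proof -
  have *: "axis i 1 \<in> product_strategies"
    if "axis i 1 = (vector [(1 - a) * (1 - b), (1 - a) * b, a * (1 - b), a * b] :: real ^ 4)"
      "a \<in> {0..1}" "b \<in> {0..1}" for i a b
    using that by (auto simp: product_strategies_def)
  have "axis i 1 \<in> product_strategies" for i
    using exhaust_4[of i] *[of i 0 0] *[of i 0 1] *[of i 1 0] *[of i 1 1]
    by (auto simp: vec_eq_iff forall_4 vector_4 axis_def)
  then show ?thesis by blast
qed

theorem proposition1:
  fixes A :: "real ^ 'n ^ 4"
  shows
    "values_attained product_strategies A \<and>
     attains_max product_strategies (\<lambda>p. MIN j. (p v* A) $ j) \<and>
     lower_value product_strategies A =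
       max_on product_strategies (\<lambda>p. min_on prob_simplex (\<lambda>q. payoff A p q)) \<and>
     lower_value product_strategies A =
       max_on product_strategies (\<lambda>p. MIN j. (p v* A) $ j) \<and>
     (\<forall>p\<in>prob_simplex. attains_min prob_simplex (\<lambda>q. payoff A p q)) \<and>
     attains_max prob_simplex (\<lambda>p. min_on prob_simplex (\<lambda>q. payoff A p q)) \<and>
     attains_max prob_simplex (\<lambda>p. MIN j. (p v* A) $ j) \<and>
     upper_value product_strategies A =
       max_on prob_simplex (\<lambda>p. min_on prob_simplex (\<lambda>q. payoff A p q)) \<and>
     upper_value product_strategies A =
       max_on prob_simplex (\<lambda>p. MIN j. (p v* A) $ j) \<and>
     is_game_value A (upper_value product_strategies A) \<and>
     (lower_value product_strategies A = upper_value product_strategies A \<longleftrightarrow>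
       (\<exists>p\<in>product_strategies.
          is_arg_max (\<lambda>p. min_on prob_simplex (\<lambda>q. payoff A p q)) (\<lambda>p. p \<in> prob_simplex) p)) \<and>
     (lower_value product_strategies A = upper_value product_strategies A \<longleftrightarrow>
       (\<exists>p\<in>product_strategies.
          is_arg_max (\<lambda>p. MIN j. (p v* A) $ j) (\<lambda>p. p \<in> prob_simplex) p))"
proof -
  note simplex = compact_prob_simplex image_subsetI[OF axis_in_prob_simplex] subset_refl
  note product = axis_in_product_strategies product_strategies_subset
  have "product_strategies \<noteq> {}" using axis_in_product_strategies by blast
  then have attained:
    "attains_max product_strategies (\<lambda>p. MIN j. (p v* A) $ j)"
    "attains_max prob_simplex (\<lambda>p. MIN j. (p v* A) $ j)"
    by (simp_all add: attains_max_Min compact_product_strategies compact_prob_simplex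
        prob_simplex_nonempty)
  have upper: "upper_value product_strategies A = max_on prob_simplex (\<lambda>p. MIN j. (p v* A) $ j)"
    by (simp add: upper_value_eq[OF product] minimax)
  have "is_game_value A (upper_value product_strategies A)"
    unfolding is_game_value_def
    using values_attained_if_compact[OF simplex] upper
    by (simp add: lower_value_eq upper_value_eq[OF simplex(2,3)] minimax)
  moreover have "values_attained product_strategies A"
    by (rule values_attained_if_compact[OF compact_product_strategies product])
  ultimately show ?thesis
    using attained upper
      max_on_subset_eq_iff[OF product_strategies_subset attained]
    by (simp add: attains_min_payoff min_on_prob_simplex lower_value_eq)
qed

end
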